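(* Each asymptotically $h$-expansive action $(X,G)$ of a sofic group admits a measure with maximal entropy.
   Context: Setting: $G$ is a countable discrete sofic group with a fixed sofic approximation $\Sigma=\{\sigma_i: G \rightarrow \mathrm{Sym}(d_i),\ g\mapsto \sigma_{i, g}\}_{i\in \mathbb{N}}$, where $d_i\in\mathbb{N}$, $d_i\to\infty$, $\mathrm{Sym}(d)$ is the permutation group of $\{1,\dots,d\}$, and $\lim_{i\to\infty} \frac{1}{d_i} |\{a\in\{1,\dots,d_i\}: \sigma_{i,s}\sigma_{i,t}(a)=\sigma_{i,st}(a)\}|=1$ for all $s,t\in G$, $\lim_{i\to\infty} \frac{1}{d_i} |\{a\in\{1,\dots,d_i\}: \sigma_{i,s}(a)\neq \sigma_{i,t}(a)\}|=1$ for all distinct $s,t\in G$. $G$ acts continuously on a compact metric space $(X,\rho)$. $M(X)$ is the set of all Borel probability measures on $X$ with the weak star topology, and $M(X,G)$ is the (possibly empty) subset of $G$-invariant ones. Convention: $\log 0=-\infty$, so the entropies below may equal $-\infty$. $\mathcal{C}_X$ and $\mathcal{C}_X^o$ are the sets of finite Borel covers and of finite open covers of $X$. For a cover $\mathcal{V}$ and a set $K$, $N(\mathcal{V},K)$ is the minimal cardinality of sub-families of $\mathcal{V}$ covering $K$ (with $N(\mathcal{V},\emptyset)=0$). For $\mathcal{U}\in\mathcal{C}_X$, $\mathcal{U}^d$ is the cover of $X^d$ consisting of all products $U_1\times\cdots\times U_d$ with $U_j\in\mathcal{U}$. $\mathfrak{F}_Y$ is the set of non-empty finite subsets of a set $Y$;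 $C(X)$ is the set of real-valued continuous functions on $X$. For $F\in\mathfrak{F}_G$, $\delta>0$ and $\sigma:G\to\mathrm{Sym}(d)$, $g\mapsto\sigma_g$, put $$X^d_{F,\delta,\sigma}=\left\{(x_1,\dots,x_d)\in X^d:\max_{s\in F}\sqrt{\sum_{j=1}^d\frac1d\rho^2(sx_j,x_{\sigma_s(j)})}<\delta\right\},$$ and for $\mu\in M(X)$, $L\in\mathfrak{F}_{C(X)}$, $$X^d_{F,\delta,\sigma,\mu,L}=\left\{(x_1,\dots,x_d)\in X^d_{F,\delta,\sigma}:\max_{f\in L}\left|\frac1d\sum_{j=1}^df(x_j)-\mu(f)\right|<\delta\right\}.$$ For $\mathcal{U}\in\mathcal{C}_X$ and $\mu\in M(X)$ let $$h_\mu(G,\mathcal{U})=\inf_{L\in\mathfrak{F}_{C(X)}}\inf_{F\in\mathfrak{F}_G}\inf_{\delta>0}\limsup_{i\to\infty}\frac1{d_i}\log N\left(\mathcal{U}^{d_i},X^{d_i}_{F,\delta,\sigma_i,\mu,L}\right),\quad h(G,\mathcal{U})=\inf_{F\in\mathfrak{F}_G}\inf_{\delta>0}\limsup_{i\to\infty}\frac1{d_i}\log N\left(\mathcal{U}^{d_i},X^{d_i}_{F,\delta,\sigma_i}\right).$$ The measure-theoretic $\mu$-entropy of $(X,G)$ is $h_\mu(G,X)=\sup_{\mathcal{U}\in\mathcal{C}_X^o}h_\mu(G,\mathcal{U})$, defined for every $\mu\in M(X)$ (it equals $-\infty$ for $\mu\in M(X)\setminus M(X,G)$), and the topological entropy is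 $h(G,X)=\sup_{\mathcal{U}\in\mathcal{C}_X^o}h(G,\mathcal{U})$. The variational principle states $h(G,X)=\sup_{\mu\in M(X,G)}h_\mu(G,X)$, where the right-hand side is $-\infty$ by convention if $M(X,G)=\emptyset$. A measure with maximal entropy is a $\mu\in M(X)$ with $h_\mu(G,X)=h(G,X)$. For $\mathcal{U}_1,\mathcal{U}_2\in\mathcal{C}_X$ define $$h(G,\mathcal{U}_1|\mathcal{U}_2)=\inf_{F\in\mathfrak{F}_G}\inf_{\delta>0}\limsup_{i\to\infty}\frac1{d_i}\log\max_{V\in\mathcal{U}_2^{d_i}}N\left(\mathcal{U}_1^{d_i},X^{d_i}_{F,\delta,\sigma_i}\cap V\right),$$ $h(G,X|\mathcal{U}_2)=\sup_{\mathcal{U}_1\in\mathcal{C}_X^o}h(G,\mathcal{U}_1|\mathcal{U}_2)$ and $h^*(G,X)=\inf_{\mathcal{U}_2\in\mathcal{C}_X^o}h(G,X|\mathcal{U}_2)$. $(X,G)$ is asymptotically $h$-expansive if $h^*(G,X)\le0$. *)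

theory Defs
  imports "HOL-Probability.Probability" "HOL-Algebra.Group_Action"
    "HOL-Combinatorics.Permutations"
begin

section \<open>Sofic approximations and actions\<close>

text \<open>
  The group \<open>G\<close> is a (discrete) group in the sense of HOL-Algebra. The maps
  \<open>\<sigma> i\<close> need not be homomorphisms.
\<close>

definition sofic_approximation ::
  "('g, 'm) monoid_scheme \<Rightarrow> (nat \<Rightarrow> nat) \<Rightarrow> (nat \<Rightarrow> 'g \<Rightarrow> nat \<Rightarrow> nat) \<Rightarrow> bool" where
  "sofic_approximation G d \<sigma> \<longleftrightarrow>
     filterlim d at_top sequentially \<and>
     (\<forall>i. \<forall>s\<in>carrier G. \<sigma> i s permutes {1..d i}) \<and>
     (\<forall>s\<in>carrier G. \<forall>t\<in>carrier G.
        (\<lambda>i. 1 / real (d i) *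
           real (card {a \<in> {1..d i}. \<sigma> i s (\<sigma> i t a) = \<sigma> i (s \<otimes>\<^bsub>G\<^esub> t) a})) \<longlonglongrightarrow> 1) \<and>
     (\<forall>s\<in>carrier G. \<forall>t\<in>carrier G. s \<noteq> t \<longrightarrow>
        (\<lambda>i. 1 / real (d i) * real (card {a \<in> {1..d i}. \<sigma> i s a \<noteq> \<sigma> i t a})) \<longlonglongrightarrow> 1)"

text \<open>
  The space \<open>X\<close> is a whole type \<open>'x :: metric_space\<close> (hence non-empty), assumed compact
  where needed, and its metric is \<^const>\<open>dist\<close>.
\<close>

definition continuous_action ::
  "('g, 'm) monoid_scheme \<Rightarrow> ('g \<Rightarrow> 'x::metric_space \<Rightarrow> 'x) \<Rightarrow> bool" where
  "continuous_action G \<phi> \<longleftrightarrow>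
     group_action G UNIV \<phi> \<and> (\<forall>g\<in>carrier G. continuous_on UNIV (\<phi> g))"

section \<open>Covers\<close>

definition open_covers :: "'x::topological_space set set set" where
  "open_covers = {\<U>. finite \<U> \<and> (\<forall>U\<in>\<U>. open U) \<and> \<Union>\<U> = UNIV}"

definition covering_number :: "'y set set \<Rightarrow> 'y set \<Rightarrow> nat" where
  "covering_number \<V> K = Inf {card \<W> |\<W>. finite \<W> \<and> \<W> \<subseteq> \<V> \<and> K \<subseteq> \<Union>\<W>}"

text \<open>Points of \<open>X\<^sup>d\<close> are extensional functions on \<open>{1..d}\<close>.\<close>

definition power_cover :: "nat \<Rightarrow> 'x set set \<Rightarrow> (nat \<Rightarrow> 'x) set set" where
  "power_cover d \<U> = {PiE {1..d} U |U. \<forall>j\<in>{1..d}. U j \<in> \<U>}"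

definition elog :: "nat \<Rightarrow> ereal" where
  "elog n = (if n = 0 then - \<infinity> else ereal (ln (real n)))"

section \<open>Spaces of approximate orbits\<close>

definition fin_subsets :: "'y set \<Rightarrow> 'y set set" where
  "fin_subsets Y = {F. F \<subseteq> Y \<and> finite F \<and> F \<noteq> {}}"

definition C_real :: "('x::topological_space \<Rightarrow> real) set" where
  "C_real = {f. continuous_on UNIV f}"

definition borel_prob_measures :: "'x::topological_space measure set" where
  "borel_prob_measures = {\<mu>. sets \<mu> = sets borel \<and> prob_space \<mu>}"

text \<open>Here \<open>\<tau>\<close> is a single map from \<open>G\<close> to the permutations of \<open>{1..d}\<close>.\<close>

definition approx_orbits ::
  "('g \<Rightarrow> 'x::metric_space \<Rightarrow> 'x) \<Rightarrow> nat \<Rightarrow> 'g set \<Rightarrow> real \<Rightarrow> ('g \<Rightarrow> nat \<Rightarrow> nat)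
    \<Rightarrow> (nat \<Rightarrow> 'x) set" where
  "approx_orbits \<phi> d F \<delta> \<tau> =
     {x \<in> PiE {1..d} (\<lambda>_. UNIV).
        Max ((\<lambda>s. sqrt (\<Sum>j\<in>{1..d}. 1 / real d * (dist (\<phi> s (x j)) (x (\<tau> s j)))\<^sup>2)) ` F) < \<delta>}"

definition approx_orbits_meas ::
  "('g \<Rightarrow> 'x::metric_space \<Rightarrow> 'x) \<Rightarrow> nat \<Rightarrow> 'g set \<Rightarrow> real \<Rightarrow> ('g \<Rightarrow> nat \<Rightarrow> nat)
    \<Rightarrow> 'x measure \<Rightarrow> ('x \<Rightarrow> real) set \<Rightarrow> (nat \<Rightarrow> 'x) set" where
  "approx_orbits_meas \<phi> d F \<delta> \<tau> \<mu> L =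
     {x \<in> approx_orbits \<phi> d F \<delta> \<tau>.
        Max ((\<lambda>f. \<bar>1 / real d * (\<Sum>j\<in>{1..d}. f (x j)) - integral\<^sup>L \<mu> f\<bar>) ` L) < \<delta>}"

section \<open>Entropies\<close>

definition meas_entropy_cover ::
  "('g, 'm) monoid_scheme \<Rightarrow> (nat \<Rightarrow> nat) \<Rightarrow> (nat \<Rightarrow> 'g \<Rightarrow> nat \<Rightarrow> nat)
    \<Rightarrow> ('g \<Rightarrow> 'x::metric_space \<Rightarrow> 'x) \<Rightarrow> 'x measure \<Rightarrow> 'x set set \<Rightarrow> ereal" where
  "meas_entropy_cover G d \<sigma> \<phi> \<mu> \<U> =
     (INF L\<in>fin_subsets C_real. INF F\<in>fin_subsets (carrier G). INF \<delta>\<in>{0<..}.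
        limsup (\<lambda>i. ereal (1 / real (d i)) *
          elog (covering_number (power_cover (d i) \<U>)
                 (approx_orbits_meas \<phi> (d i) F \<delta> (\<sigma> i) \<mu> L))))"

definition top_entropy_cover ::
  "('g, 'm) monoid_scheme \<Rightarrow> (nat \<Rightarrow> nat) \<Rightarrow> (nat \<Rightarrow> 'g \<Rightarrow> nat \<Rightarrow> nat)
    \<Rightarrow> ('g \<Rightarrow> 'x::metric_space \<Rightarrow> 'x) \<Rightarrow> 'x set set \<Rightarrow> ereal" where
  "top_entropy_cover G d \<sigma> \<phi> \<U> =
     (INF F\<in>fin_subsets (carrier G). INF \<delta>\<in>{0<..}.
        limsup (\<lambda>i. ereal (1 / real (d i)) *
          elog (covering_number (power_cover (d i) \<U>) (approx_orbits \<phi> (d i) F \<delta> (\<sigma> i)))))"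

definition meas_entropy ::
  "('g, 'm) monoid_scheme \<Rightarrow> (nat \<Rightarrow> nat) \<Rightarrow> (nat \<Rightarrow> 'g \<Rightarrow> nat \<Rightarrow> nat)
    \<Rightarrow> ('g \<Rightarrow> 'x::metric_space \<Rightarrow> 'x) \<Rightarrow> 'x measure \<Rightarrow> ereal" where
  "meas_entropy G d \<sigma> \<phi> \<mu> = (SUP \<U>\<in>open_covers. meas_entropy_cover G d \<sigma> \<phi> \<mu> \<U>)"

definition top_entropy ::
  "('g, 'm) monoid_scheme \<Rightarrow> (nat \<Rightarrow> nat) \<Rightarrow> (nat \<Rightarrow> 'g \<Rightarrow> nat \<Rightarrow> nat)
    \<Rightarrow> ('g \<Rightarrow> 'x::metric_space \<Rightarrow> 'x) \<Rightarrow> ereal" where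
  "top_entropy G d \<sigma> \<phi> = (SUP \<U>\<in>open_covers. top_entropy_cover G d \<sigma> \<phi> \<U>)"

definition maximal_entropy_measure ::
  "('g, 'm) monoid_scheme \<Rightarrow> (nat \<Rightarrow> nat) \<Rightarrow> (nat \<Rightarrow> 'g \<Rightarrow> nat \<Rightarrow> nat)
    \<Rightarrow> ('g \<Rightarrow> 'x::metric_space \<Rightarrow> 'x) \<Rightarrow> 'x measure \<Rightarrow> bool" where
  "maximal_entropy_measure G d \<sigma> \<phi> \<mu> \<longleftrightarrow>
     \<mu> \<in> borel_prob_measures \<and> meas_entropy G d \<sigma> \<phi> \<mu> = top_entropy G d \<sigma> \<phi>"

section \<open>Asymptotic h-expansiveness\<close>

definition cond_entropy_covers ::
  "('g, 'm) monoid_scheme \<Rightarrow> (nat \<Rightarrow> nat) \<Rightarrow> (nat \<Rightarrow> 'g \<Rightarrow> nat \<Rightarrow> nat)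
    \<Rightarrow> ('g \<Rightarrow> 'x::metric_space \<Rightarrow> 'x) \<Rightarrow> 'x set set \<Rightarrow> 'x set set \<Rightarrow> ereal" where
  "cond_entropy_covers G d \<sigma> \<phi> \<U>1 \<U>2 =
     (INF F\<in>fin_subsets (carrier G). INF \<delta>\<in>{0<..}.
        limsup (\<lambda>i. ereal (1 / real (d i)) *
          elog (Max ((\<lambda>V. covering_number (power_cover (d i) \<U>1)
                            (approx_orbits \<phi> (d i) F \<delta> (\<sigma> i) \<inter> V))
                     ` power_cover (d i) \<U>2))))"

definition cond_entropy ::
  "('g, 'm) monoid_scheme \<Rightarrow> (nat \<Rightarrow> nat) \<Rightarrow> (nat \<Rightarrow> 'g \<Rightarrow> nat \<Rightarrow> nat)
    \<Rightarrow> ('g \<Rightarrow> 'x::metric_space \<Rightarrow> 'x) \<Rightarrow> 'x set set \<Rightarrow> ereal" where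
  "cond_entropy G d \<sigma> \<phi> \<U>2 = (SUP \<U>1\<in>open_covers. cond_entropy_covers G d \<sigma> \<phi> \<U>1 \<U>2)"

definition tail_entropy ::
  "('g, 'm) monoid_scheme \<Rightarrow> (nat \<Rightarrow> nat) \<Rightarrow> (nat \<Rightarrow> 'g \<Rightarrow> nat \<Rightarrow> nat)
    \<Rightarrow> ('g \<Rightarrow> 'x::metric_space \<Rightarrow> 'x) \<Rightarrow> ereal" where
  "tail_entropy G d \<sigma> \<phi> = (INF \<U>2\<in>open_covers. cond_entropy G d \<sigma> \<phi> \<U>2)"

definition asymptotically_h_expansive ::
  "('g, 'm) monoid_scheme \<Rightarrow> (nat \<Rightarrow> nat) \<Rightarrow> (nat \<Rightarrow> 'g \<Rightarrow> nat \<Rightarrow> nat)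
    \<Rightarrow> ('g \<Rightarrow> 'x::metric_space \<Rightarrow> 'x) \<Rightarrow> bool" where
  "asymptotically_h_expansive G d \<sigma> \<phi> \<longleftrightarrow> tail_entropy G d \<sigma> \<phi> \<le> 0"

end

(*
  Suppose that every Borel probability measure mu has entropy below h = h(G,X), and choose reals
  h_mu(G,X) < a < b < h. By asymptotic h-expansiveness some open cover U has h(G,X|U) < b - a, and
  h_mu(G,U) < a is witnessed by finitely many group elements, finitely many test functions and a
  tolerance, that is, by a weak* neighbourhood of mu. Finitely many such neighbourhoods cover all
  measures, in particular all empirical measures of approximate orbits, so the approximate orbits
  split into finitely many pieces. For every open cover V the piece near mu is covered by
  exp(a d) exp((b - a) d) = exp(b d) members of V^d, and hence h(G,V) is at most the maximum of the
  finitely many b's. As V is arbitrary, h <= max b < h.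

  Weak* compactness is obtained on the real line: a ternary expansion recording membership in a
  countable base is a Borel map e from X into [0,1] whose inverse is uniformly continuous and
  extends to a continuous map from the closure of e(X) onto X. Measures are moved to [0,1] by e,
  a subsequence converges by Helly's theorem, and the limit is pushed back to X.
*)
theory Submission
  imports Defs
begin

section \<open>Weak compactness of the space of measures\<close>

text \<open>The Cantor point with ternary digits \<open>2 * of_bool (b k)\<close>: leaving out the
  digit 1 makes the digits recoverable from the value in a stable way.\<close>

definition ternary :: "(nat \<Rightarrow> bool) \<Rightarrow> real" where
  "ternary b = (\<Sum>k. (2 / 3) * of_bool (b k) * (1 / 3) ^ k)"

lemma summable_ternary: "summable (\<lambda>k. (2 / 3) * of_bool (b k) * (1 / 3) ^ k :: real)"
  by (rule summable_comparison_test'[of "\<lambda>k. (1 / 3) ^ k :: real" 0])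
     (auto intro: summable_geometric)

lemma ternary_bounds: "0 \<le> ternary b" "ternary b \<le> 1"
proof -
  show "0 \<le> ternary b"
    unfolding ternary_def by (rule suminf_nonneg[OF summable_ternary]) auto
  have "(\<lambda>k. (2 / 3) * (1 / 3) ^ k :: real) sums ((2 / 3) * (1 / (1 - 1 / 3)))"
    by (intro sums_mult geometric_sums) auto
  moreover have "ternary b \<le> (\<Sum>k. (2 / 3) * (1 / 3) ^ k :: real)"
    unfolding ternary_def
    by (rule suminf_le[OF _ summable_ternary]) (auto intro: summable_geometric)
  ultimately show "ternary b \<le> 1"
    by (simp add: sums_iff)
qed

lemma ternary_rec: "ternary b = (2 * of_bool (b 0) + ternary (\<lambda>k. b (Suc k))) / 3"
proof -
  have "ternary b = 2 / 3 * of_bool (b 0) +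
      (\<Sum>k. (1 / 3) * ((2 / 3) * of_bool (b (Suc k)) * (1 / 3) ^ k))"
    using suminf_split_head[OF summable_ternary[of b]]
    unfolding ternary_def by (simp add: mult.assoc mult.left_commute)
  also have "\<dots> = 2 / 3 * of_bool (b 0) + (1 / 3) * ternary (\<lambda>k. b (Suc k))"
    unfolding ternary_def by (subst suminf_mult[OF summable_ternary]) simp
  finally show ?thesis by (simp add: field_simps)
qed

text \<open>If the first digits differ, \<open>ternary_rec\<close> separates the values by at least
  1/3, since both tails lie in [0,1]. If they agree, the tails are three times as far apart as the
  values, which feeds the induction.\<close>

lemma ternary_close_imp_prefix_eq:
  assumes "\<bar>ternary b - ternary b'\<bar> < (1 / 3) ^ n" and "k < n"
  shows "b k = b' k"
  using assms
proof (induction n arbitrary: b b' k)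
  case (Suc n)
  let ?t = "ternary (\<lambda>k. b (Suc k))" and ?t' = "ternary (\<lambda>k. b' (Suc k))"
  have diff: "ternary b - ternary b' = (2 * (of_bool (b 0) - of_bool (b' 0)) + (?t - ?t')) / 3"
    unfolding ternary_rec[of b] ternary_rec[of b'] by (simp add: field_simps)
  have lt: "\<bar>2 * (of_bool (b 0) - of_bool (b' 0)) + (?t - ?t')\<bar> < (1 / 3) ^ n"
    using Suc.prems(1) unfolding diff by (simp add: field_simps)
  have "\<bar>?t - ?t'\<bar> \<le> 1" "(1 / 3 :: real) ^ n \<le> 1"
    using ternary_bounds[of "\<lambda>k. b (Suc k)"] ternary_bounds[of "\<lambda>k. b' (Suc k)"]
    by (auto intro: power_le_one)
  with lt have head: "b 0 = b' 0"
    by (cases "b 0"; cases "b' 0") auto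
  with lt have "\<bar>?t - ?t'\<bar> < (1 / 3) ^ n" by simp
  with Suc.IH[of "\<lambda>k. b (Suc k)" "\<lambda>k. b' (Suc k)"] Suc.prems(2) head show ?case
    by (cases k) auto
qed simp

section \<open>Borel coding of a compact metric space by reals\<close>

text \<open>The code of a point records which balls of a countable family contain it. Indicators of
  balls are only Borel, so \<open>e\<close> need not be continuous; but a long enough common prefix
  of two codes puts the points in a common small ball.\<close>

lemma compact_metric_borel_code:
  assumes "compact (UNIV :: 'x::metric_space set)"
  obtains e :: "'x::metric_space \<Rightarrow> real" where "e \<in> borel_measurable borel" "range e \<subseteq> {0..1}"
    "\<And>\<epsilon>. \<epsilon> > 0 \<Longrightarrow> \<exists>\<delta>>0. \<forall>x y. \<bar>e x - e y\<bar> < \<delta> \<longrightarrow> dist x y < \<epsilon>"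
proof -
  have "\<forall>n::nat. \<exists>k. finite k \<and> (UNIV::'x::metric_space set) \<subseteq> (\<Union>x\<in>k. ball x (1 / real (Suc n)))"
  proof
    fix n
    show "\<exists>k. finite k \<and> (UNIV::'x::metric_space set) \<subseteq> (\<Union>x\<in>k. ball x (1 / real (Suc n)))"
      using assms unfolding compact_eq_totally_bounded
      by (metis divide_pos_pos of_nat_0_less_iff zero_less_Suc zero_less_one)
  qed
  then obtain net where net: "\<And>n. finite (net n)"
    "\<And>n. (UNIV::'x::metric_space set) \<subseteq> (\<Union>x\<in>net n. ball x (1 / real (Suc n)))"
    by metis
  define \<B> where "\<B> = (\<Union>n. (\<lambda>x. ball x (1 / real (Suc n))) ` net n)"
  have cB: "countable \<B>"
    unfolding \<B>_def using net(1) by (auto intro: countable_finite)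
  have neB: "\<B> \<noteq> {}"
  proof -
    have "net 0 \<noteq> {}" using net(2)[of 0] by auto
    then show ?thesis unfolding \<B>_def by blast
  qed
  define U where "U = from_nat_into \<B>"
  have UB: "U k \<in> \<B>" for k
    unfolding U_def by (rule from_nat_into[OF neB])
  have openU: "open (U k)" for k
    using UB[of k] unfolding \<B>_def by auto
  define e where "e x = ternary (\<lambda>k. x \<in> U k)" for x
  show thesis
  proof
    have "(\<lambda>x. (2 / 3) * of_bool (x \<in> U k) * (1 / 3) ^ k :: real) \<in> borel_measurable borel" for k
    proof -
      have "(\<lambda>x. (2 / 3) * of_bool (x \<in> U k) * (1 / 3) ^ k :: real)
          = (\<lambda>x. (2 / 3) * indicator (U k) x * (1 / 3) ^ k)"
        by (auto simp: indicator_def)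
      then show ?thesis using borel_open[OF openU[of k]] by simp
    qed
    then show "e \<in> borel_measurable borel"
      unfolding e_def ternary_def by (rule borel_measurable_suminf)
    show "range e \<subseteq> {0..1}"
      unfolding e_def using ternary_bounds by auto
  next
    fix \<epsilon> :: real assume "\<epsilon> > 0"
    then obtain n where n: "1 / real (Suc n) < \<epsilon> / 2"
      using nat_approx_posE[of "\<epsilon> / 2"] by auto
    \<comment> \<open>These are the indices of the finitely many balls of the \<open>n\<close>-th
      net. Codes closer than \<open>(1 / 3) ^ Suc (Max I)\<close> agree up to and including
      \<open>Max I\<close>, hence on a ball containing \<open>x\<close>; two points of that ball are
      less than \<epsilon> apart.\<close>
    define I where "I = (\<lambda>x. to_nat_on \<B> (ball x (1 / real (Suc n)))) ` net n"
    have finI: "finite I" unfolding I_def using net(1) by auto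
    have "dist x y < \<epsilon>" if close: "\<bar>e x - e y\<bar> < (1 / 3) ^ (Suc (Max I))" for x y
    proof -
      have "x \<in> (\<Union>z\<in>net n. ball z (1 / real (Suc n)))"
        using net(2)[of n] by (rule subsetD) simp
      then obtain z where z: "z \<in> net n" "x \<in> ball z (1 / real (Suc n))"
        by (rule UN_E)
      define k where "k = to_nat_on \<B> (ball z (1 / real (Suc n)))"
      have Uk: "U k = ball z (1 / real (Suc n))"
        unfolding U_def k_def using z(1) by (intro from_nat_into_to_nat_on[OF cB]) (auto simp: \<B>_def)
      have "k \<in> I" using z(1) by (auto simp: I_def k_def)
      then have "k < Suc (Max I)" using Max_ge[OF finI] by (simp add: less_Suc_eq_le)
      from ternary_close_imp_prefix_eq[OF close[unfolded e_def] this]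
      have "y \<in> U k" using z(2) Uk by simp
      then have "dist z x < 1 / real (Suc n)" "dist z y < 1 / real (Suc n)"
        using z(2) Uk by auto
      with n dist_triangle3[of x y z] show ?thesis by simp
    qed
    then show "\<exists>\<delta>>0. \<forall>x y. \<bar>e x - e y\<bar> < \<delta> \<longrightarrow> dist x y < \<epsilon>"
      by (intro exI[of _ "(1 / 3) ^ (Suc (Max I))"]) auto
  qed
qed

text \<open>The uniformly continuous inverse of \<open>e\<close> extends to the compact closure
  \<open>K\<close> of the range, limits existing because X is compact. Thus a continuous
  \<open>f\<close> on X becomes the continuous \<open>f o p\<close> on \<open>K\<close>, although
  \<open>e\<close> is only Borel.\<close>

lemma compact_metric_borel_parametrization:
  assumes cpt: "compact (UNIV :: 'x::metric_space set)"
  obtains e :: "'x::metric_space \<Rightarrow> real" and p K where "e \<in> borel_measurable borel" "range e \<subseteq> K"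
    "compact K" "continuous_on K p" "\<And>x. p (e x) = x"
proof -
  obtain e :: "'x::metric_space \<Rightarrow> real" where e: "e \<in> borel_measurable borel" "range e \<subseteq> {0..1}"
    and modulus: "\<And>\<epsilon>. \<epsilon> > 0 \<Longrightarrow> \<exists>\<delta>>0. \<forall>x y. \<bar>e x - e y\<bar> < \<delta> \<longrightarrow> dist x y < \<epsilon>"
    using compact_metric_borel_code[OF cpt] by metis
  define K where "K = closure (range e)"
  \<comment> \<open>The closure of the graph of \<open>e\<inverse>\<close>: library extension theorems need a complete target type class.\<close>
  define near where "near r z \<longleftrightarrow> (\<forall>\<epsilon>>0. \<exists>x. \<bar>e x - r\<bar> < \<epsilon> \<and> dist x z < \<epsilon>)" for r z
  have ex_near: "\<exists>z. near r z" if "r \<in> K" for r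
  proof -
    have "\<exists>s. (\<forall>n. s n \<in> range e) \<and> s \<longlonglongrightarrow> r"
      using that unfolding K_def closure_sequential .
    then obtain s where s: "\<And>n. s n \<in> range e" "s \<longlonglongrightarrow> r" by metis
    then have "\<forall>n. \<exists>x. s n = e x" by blast
    then obtain x where x: "\<And>n. s n = e (x n)" by metis
    obtain z \<pi> where z: "strict_mono \<pi>" "(x \<circ> \<pi>) \<longlonglongrightarrow> z"
      using compact_imp_seq_compact[OF cpt] unfolding seq_compact_def by (metis UNIV_I)
    have "near r z" unfolding near_def
    proof (intro allI impI)
      fix \<epsilon> :: real assume "\<epsilon> > 0"
      have "\<forall>\<^sub>F n in sequentially. dist ((s \<circ> \<pi>) n) r < \<epsilon>"
        using LIMSEQ_subseq_LIMSEQ[OF s(2) z(1)] \<open>\<epsilon> > 0\<close> by (rule tendstoD)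
      moreover have "\<forall>\<^sub>F n in sequentially. dist ((x \<circ> \<pi>) n) z < \<epsilon>"
        using z(2) \<open>\<epsilon> > 0\<close> by (rule tendstoD)
      ultimately have "\<forall>\<^sub>F n in sequentially. dist ((s \<circ> \<pi>) n) r < \<epsilon> \<and> dist ((x \<circ> \<pi>) n) z < \<epsilon>"
        by eventually_elim simp
      then show "\<exists>x. \<bar>e x - r\<bar> < \<epsilon> \<and> dist x z < \<epsilon>"
        by (auto simp: x dist_real_def dest!: eventually_happens)
    qed
    then show ?thesis ..
  qed
  \<comment> \<open>The case \<open>r = r'\<close> gives uniqueness of the limit, so the arbitrary
    choice in \<open>p\<close> is harmless; the general case gives uniform continuity of
    \<open>p\<close>.\<close>
  have near_close: "\<exists>\<delta>>0. \<forall>r r' z z'. near r z \<and> near r' z' \<and> dist r r' < \<delta> \<longrightarrow> dist z z' < \<epsilon>"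
    if "\<epsilon> > 0" for \<epsilon> :: real
  proof -
    obtain \<delta> where \<delta>: "\<delta> > 0" "\<And>x y. \<bar>e x - e y\<bar> < \<delta> \<Longrightarrow> dist x y < \<epsilon> / 3"
      using modulus[of "\<epsilon> / 3"] \<open>\<epsilon> > 0\<close> by auto
    have "dist z z' < \<epsilon>" if h: "near r z" "near r' z'" "dist r r' < \<delta> / 3" for r r' z z'
    proof -
      have "min (\<delta> / 3) (\<epsilon> / 3) > 0" using \<delta> \<open>\<epsilon> > 0\<close> by simp
      then obtain x x' where x: "\<bar>e x - r\<bar> < min (\<delta> / 3) (\<epsilon> / 3)" "dist x z < min (\<delta> / 3) (\<epsilon> / 3)"
        "\<bar>e x' - r'\<bar> < min (\<delta> / 3) (\<epsilon> / 3)" "dist x' z' < min (\<delta> / 3) (\<epsilon> / 3)"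
        using h unfolding near_def by metis
      have "\<bar>e x - e x'\<bar> < \<delta>" using x(1,3) h(3) unfolding dist_real_def by linarith
      from \<delta>(2)[OF this] x show ?thesis
        using dist_triangle[of z z' x'] dist_triangle[of z x' x] by (simp add: dist_commute)
    qed
    with \<delta>(1) show ?thesis by (intro exI[of _ "\<delta> / 3"]) auto
  qed
  define p where "p r = (SOME z. near r z)" for r
  have near_p: "near r (p r)" if "r \<in> K" for r
    unfolding p_def by (rule someI_ex[OF ex_near[OF that]])
  have near_e: "near (e x) x" for x
    unfolding near_def by (auto intro!: exI[of _ x])
  have range_K: "range e \<subseteq> K" unfolding K_def by (rule closure_subset)
  show thesis
  proof
    show "continuous_on K p"
      unfolding continuous_on_iff
    proof (intro ballI allI impI)
      fix r \<epsilon> assume "r \<in> K" "(\<epsilon>::real) > 0"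
      then show "\<exists>\<delta>>0. \<forall>r'\<in>K. dist r' r < \<delta> \<longrightarrow> dist (p r') (p r) < \<epsilon>"
        using near_close[of \<epsilon>] near_p by meson
    qed
    show "compact K" unfolding K_def compact_closure
      by (rule bounded_subset[OF _ e(2)]) simp
    show "p (e x) = x" for x
    proof (rule ccontr)
      assume "p (e x) \<noteq> x"
      then have "dist (p (e x)) x > 0" by simp
      from near_close[OF this] near_p[of "e x"] near_e[of x] range_K show False
        by (metis dist_self less_irrefl rangeI subsetD)
    qed
  qed (use e range_K in auto)
qed

section \<open>Sequential compactness of Borel probability measures\<close>

lemma borel_prob_measuresD:
  assumes "\<mu> \<in> borel_prob_measures"
  shows "prob_space \<mu>" "sets \<mu> = sets borel" "space \<mu> = UNIV"
  using assms sets_eq_imp_space_eq[of \<mu> borel] by (auto simp: borel_prob_measures_def)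

lemma borel_prob_measures_integrable:
  fixes f :: "'x::topological_space \<Rightarrow> real"
  assumes "\<mu> \<in> borel_prob_measures" "f \<in> borel_measurable borel" "\<And>x. \<bar>f x\<bar> \<le> B"
  shows "integrable \<mu> f"
proof -
  interpret prob_space \<mu> by (rule borel_prob_measuresD(1)[OF assms(1)])
  have "f \<in> borel_measurable \<mu>"
    using assms(2) measurable_cong_sets[OF borel_prob_measuresD(2)[OF assms(1)] refl] by blast
  then show ?thesis
    by (intro integrable_const_bound[of f B]) (use assms(3) in auto)
qed

lemma C_real_bounded:
  assumes "compact (UNIV :: 'x::metric_space set)" "(f :: 'x \<Rightarrow> real) \<in> C_real"
  obtains B where "\<And>x. \<bar>f x\<bar> \<le> B"
proof -
  have "bounded (range f)"
    using assms by (intro compact_imp_bounded compact_continuous_image) (auto simp: C_real_def)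
  then show thesis using that by (auto simp: bounded_iff)
qed

text \<open>Weak convergence on the line is enough although \<open>e\<close> is only Borel:
  \<open>f x = f (p (e x))\<close>, and \<open>f o p\<close> extends by Tietze from \<open>K\<close>
  to a bounded continuous test function for the image measures.\<close>

lemma weak_sequential_compactness:
  fixes \<nu> :: "nat \<Rightarrow> 'x::metric_space measure"
  assumes cpt: "compact (UNIV :: 'x set)" and \<nu>: "\<And>n. \<nu> n \<in> borel_prob_measures"
  obtains \<mu> r where "\<mu> \<in> borel_prob_measures" "strict_mono (r :: nat \<Rightarrow> nat)"
    "\<And>f. f \<in> C_real \<Longrightarrow> (\<lambda>n. integral\<^sup>L (\<nu> (r n)) f) \<longlonglongrightarrow> integral\<^sup>L \<mu> f"
proof -
  obtain e :: "'x \<Rightarrow> real" and p K where e[measurable]: "e \<in> borel_measurable borel"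
    and K: "range e \<subseteq> K" "compact K" and p: "continuous_on K p" "\<And>x. p (e x) = x"
    using compact_metric_borel_parametrization[OF cpt] by metis
  have closed_K: "closed K" using K(2) by (rule compact_imp_closed)
  have ne_K: "K \<noteq> {}" using K(1) by auto
  have e_\<nu>: "e \<in> measurable (\<nu> n) borel" for n
    using e measurable_cong_sets[OF borel_prob_measuresD(2)[OF \<nu>] refl] by blast
  define \<kappa> where "\<kappa> n = distr (\<nu> n) borel e" for n
  have real_\<kappa>: "real_distribution (\<kappa> n)" for n
    unfolding \<kappa>_def using borel_prob_measuresD(1)[OF \<nu>] e_\<nu>
    by (intro real_distribution.intro real_distribution_axioms.intro prob_space.prob_space_distr) auto
  have int_\<kappa>: "integral\<^sup>L (\<kappa> n) h = integral\<^sup>L (\<nu> n) (\<lambda>x. h (e x))"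
    if "h \<in> borel_measurable borel" for h :: "real \<Rightarrow> real" and n
    unfolding \<kappa>_def by (rule integral_distr[OF e_\<nu> that])
  \<comment> \<open>Tightness is stated with half-open intervals; the extra 1 on the left keeps
    \<open>K\<close> off the excluded endpoint. One interval carries all the image measures.\<close>
  obtain a b where ab: "a < b" "K \<subseteq> {a<..b}"
  proof -
    obtain B where B: "\<And>t. t \<in> K \<Longrightarrow> \<bar>t\<bar> \<le> B"
      using compact_imp_bounded[OF K(2)] by (auto simp: bounded_iff)
    show thesis
    proof (rule that[of "- \<bar>B\<bar> - 1" "\<bar>B\<bar>"])
      show "K \<subseteq> {- \<bar>B\<bar> - 1<..\<bar>B\<bar>}" using B by fastforce
    qed simp
  qed
  have mass: "measure (\<kappa> n) {a<..b} = 1" for n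
  proof -
    interpret prob_space "\<nu> n" by (rule borel_prob_measuresD(1)[OF \<nu>])
    have "e -` {a<..b} \<inter> space (\<nu> n) = space (\<nu> n)"
      using K(1) ab(2) by auto
    then show ?thesis unfolding \<kappa>_def by (subst measure_distr[OF e_\<nu>]) (auto simp: prob_space)
  qed
  have "\<exists>a b. a < b \<and> (\<forall>n. measure (\<kappa> n) {a<..b} > 1 - \<epsilon>)" if "\<epsilon> > 0" for \<epsilon>
    by (rule exI[of _ a], rule exI[of _ b]) (use ab(1) mass that in simp)
  then have "tight \<kappa>"
    unfolding tight_def using real_\<kappa> by blast
  from tight_imp_convergent_subsubsequence[OF this strict_mono_id]
  obtain r M where r: "strict_mono (r :: nat \<Rightarrow> nat)" and M: "real_distribution M"
    and conv: "weak_conv_m (\<kappa> \<circ> r) M" by auto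
  interpret M: real_distribution M by (rule M)
  have lim: "(\<lambda>n. integral\<^sup>L (\<nu> (r n)) (\<lambda>x. h (e x))) \<longlonglongrightarrow> integral\<^sup>L M h"
    if h: "continuous_on UNIV h" "\<And>t. \<bar>h t\<bar> \<le> B" for h :: "real \<Rightarrow> real" and B
  proof -
    have "(\<lambda>n. integral\<^sup>L ((\<kappa> \<circ> r) n) h) \<longlonglongrightarrow> integral\<^sup>L M h"
      using real_\<kappa> M conv h
      by (intro weak_conv_imp_integral_bdd_continuous_conv[of "\<kappa> \<circ> r" M h B])
         (auto simp: continuous_on_eq_continuous_at)
    then show ?thesis
      using int_\<kappa>[OF borel_measurable_continuous_onI[OF h(1)]] by simp
  qed
  \<comment> \<open>The distance to \<open>K\<close>, cut off at 1 to be a bounded test function,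
    vanishes at every code. Its integrals are 0 along the sequence, hence also in the limit.\<close>
  have AE_K: "AE t in M. t \<in> K"
  proof -
    define g where "g t = min 1 (infdist t K)" for t
    have cont_g: "continuous_on UNIV g" unfolding g_def by (intro continuous_intros)
    have bdd_g: "\<bar>g t\<bar> \<le> 1" for t unfolding g_def by (auto simp: infdist_nonneg)
    have ge: "g (e x) = 0" for x
    proof -
      have "infdist (e x) K = 0" using K(1) by (intro infdist_zero) auto
      then show ?thesis by (simp add: g_def)
    qed
    have int_g: "integrable M g"
      using bdd_g borel_measurable_continuous_onI[OF cont_g] by (intro M.integrable_const_bound[of _ 1]) auto
    from lim[OF cont_g bdd_g] have "integral\<^sup>L M g = 0"
      by (simp add: ge LIMSEQ_const_iff)
    then have "AE t in M. g t = 0"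
      using integral_nonneg_eq_0_iff_AE[OF int_g] by (auto simp: g_def infdist_nonneg)
    then show ?thesis
    proof eventually_elim
      case (elim t)
      then have "infdist t K = 0" by (auto simp: g_def min_def split: if_splits)
      then show ?case using in_closed_iff_infdist_zero[OF closed_K ne_K] by simp
    qed
  qed
  \<comment> \<open>The values of \<open>p\<close> off \<open>K\<close> are uncontrolled; a constant
    there makes the map Borel and changes it only on a null set of \<open>M\<close>.\<close>
  define p' where "p' t = (if t \<in> K then p t else undefined)" for t
  have p'[measurable]: "p' \<in> borel_measurable borel"
    unfolding p'_def using closed_K p(1)
    by (intro borel_measurable_continuous_on_if) (auto intro: borel_closed)
  have p'_M: "p' \<in> measurable M borel" using p' by simp
  define \<mu> where "\<mu> = distr M borel p'"
  show thesis
  proof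
    show "\<mu> \<in> borel_prob_measures"
      unfolding \<mu>_def borel_prob_measures_def using M.prob_space_distr[OF p'_M] by simp
    show "strict_mono r" by (rule r)
    fix f :: "'x \<Rightarrow> real" assume f: "f \<in> C_real"
    then have f_meas: "f \<in> borel_measurable borel"
      by (auto simp: C_real_def intro: borel_measurable_continuous_onI)
    obtain B where B: "\<And>x. \<bar>f x\<bar> \<le> B" using C_real_bounded[OF cpt f] by metis
    have "continuous_on K (\<lambda>t. f (p t))"
      using f p(1) by (auto simp: C_real_def intro: continuous_on_compose2)
    moreover have "0 \<le> B" using B[of undefined] by linarith
    ultimately obtain h where h: "continuous_on UNIV h" "\<And>t. t \<in> K \<Longrightarrow> h t = f (p t)"
      "\<And>t. \<bar>h t\<bar> \<le> B"
      using Tietze[of K "\<lambda>t. f (p t)" UNIV B] closed_K B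
      by (metis UNIV_I closed_closedin subtopology_UNIV real_norm_def)
    have "integral\<^sup>L \<mu> f = integral\<^sup>L M (\<lambda>t. f (p' t))"
      unfolding \<mu>_def by (rule integral_distr[OF p'_M f_meas])
    also have "\<dots> = integral\<^sup>L M h"
    proof (rule integral_cong_AE)
      show "(\<lambda>t. f (p' t)) \<in> borel_measurable M"
        using measurable_compose[OF p'_M f_meas] .
      show "h \<in> borel_measurable M"
        using borel_measurable_continuous_onI[OF h(1)] by simp
      show "AE t in M. f (p' t) = h t"
        using AE_K by eventually_elim (simp add: p'_def h(2))
    qed
    moreover have "h (e x) = f x" for x
      using h(2)[of "e x"] K(1) p(2)[of x] by auto
    ultimately show "(\<lambda>n. integral\<^sup>L (\<nu> (r n)) f) \<longlonglongrightarrow> integral\<^sup>L \<mu> f"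
      using lim[OF h(1,3)] by simp
  qed
qed

section \<open>From sequential compactness to finite subcovers\<close>

text \<open>Weierstrass approximation of \<open>f o p\<close> on \<open>K\<close>, with
  \<open>e x\<close> substituted. Consequently finitely many moments of \<open>e\<close> determine
  the integral of \<open>f\<close> up to a prescribed error.\<close>

lemma C_real_approx_by_code_polynomial:
  assumes cpt: "compact (UNIV :: 'x::metric_space set)"
  obtains e :: "'x::metric_space \<Rightarrow> real" where "e \<in> borel_measurable borel" "bounded (range e)"
    "\<And>f \<epsilon>. f \<in> C_real \<Longrightarrow> \<epsilon> > 0 \<Longrightarrow> \<exists>a n. \<forall>x. \<bar>f x - (\<Sum>i\<le>n. a i * e x ^ i)\<bar> < \<epsilon>"
proof -
  obtain e :: "'x \<Rightarrow> real" and p K where e: "e \<in> borel_measurable borel" "range e \<subseteq> K"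
    and K: "compact K" and p: "continuous_on K p" "\<And>x. p (e x) = x"
    using compact_metric_borel_parametrization[OF cpt] by metis
  show thesis
  proof
    show "e \<in> borel_measurable borel" by (rule e)
    show "bounded (range e)" using compact_imp_bounded[OF K] e(2) by (rule bounded_subset)
    fix f :: "'x \<Rightarrow> real" and \<epsilon> :: real assume "f \<in> C_real" "\<epsilon> > 0"
    then have "continuous_on K (\<lambda>t. f (p t))"
      using p(1) by (auto simp: C_real_def intro: continuous_on_compose2)
    from Stone_Weierstrass_real_polynomial_function[OF K this \<open>\<epsilon> > 0\<close>]
    obtain g where g: "real_polynomial_function g" "\<And>t. t \<in> K \<Longrightarrow> \<bar>f (p t) - g t\<bar> < \<epsilon>" by metis
    from g(1) obtain a n where "g = (\<lambda>t. \<Sum>i\<le>n. a i * t ^ i)"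
      unfolding real_polynomial_function_iff_sum by blast
    with g(2) e(2) p(2) have "\<forall>x. \<bar>f x - (\<Sum>i\<le>n. a i * e x ^ i)\<bar> < \<epsilon>"
      by (metis rangeI subsetD)
    then show "\<exists>a n. \<forall>x. \<bar>f x - (\<Sum>i\<le>n. a i * e x ^ i)\<bar> < \<epsilon>" by blast
  qed
qed

text \<open>
  The moments of \<open>e\<close> map the measures into a second countable space, so the Lindeloef property
  reduces compactness to sequential compactness.
\<close>

lemma weak_finite_subcover:
  fixes L :: "'x::metric_space measure \<Rightarrow> ('x \<Rightarrow> real) set"
  assumes cpt: "compact (UNIV :: 'x set)"
    and L: "\<And>\<mu>. \<mu> \<in> borel_prob_measures \<Longrightarrow> finite (L \<mu>) \<and> L \<mu> \<subseteq> C_real"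
    and \<eta>: "\<And>\<mu>. \<mu> \<in> borel_prob_measures \<Longrightarrow> \<eta> \<mu> > (0::real)"
  obtains S where "finite S" "S \<subseteq> borel_prob_measures"
    "\<And>\<nu>. \<nu> \<in> borel_prob_measures \<Longrightarrow>
       \<exists>\<mu>\<in>S. \<forall>f\<in>L \<mu>. \<bar>integral\<^sup>L \<nu> f - integral\<^sup>L \<mu> f\<bar> < \<eta> \<mu>"
proof -
  define W where "W \<mu> = {\<nu>. \<forall>f\<in>L \<mu>. \<bar>integral\<^sup>L \<nu> f - integral\<^sup>L \<mu> f\<bar> < \<eta> \<mu>}" for \<mu>
  obtain e :: "'x \<Rightarrow> real" where e: "e \<in> borel_measurable borel" "bounded (range e)"
    and approx: "\<And>f \<epsilon>. f \<in> C_real \<Longrightarrow> \<epsilon> > 0 \<Longrightarrow> \<exists>a n. \<forall>x. \<bar>f x - (\<Sum>i\<le>n. a i * e x ^ i)\<bar> < \<epsilon>"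
    using C_real_approx_by_code_polynomial[OF cpt] by metis
  obtain B where B: "\<And>x. \<bar>e x\<bar> \<le> B"
    using e(2) by (auto simp: bounded_iff)
  define moments :: "'x measure \<Rightarrow> nat \<Rightarrow> real" where "moments \<nu> i = integral\<^sup>L \<nu> (\<lambda>x. e x ^ i)" for \<nu> i
  have int_pow: "integrable \<nu> (\<lambda>x. e x ^ i)" if "\<nu> \<in> borel_prob_measures" for \<nu> i
  proof (rule borel_prob_measures_integrable[OF that])
    show "(\<lambda>x. e x ^ i) \<in> borel_measurable borel" using e(1) by simp
    show "\<bar>e x ^ i\<bar> \<le> B ^ i" for x
      using B[of x] by (auto simp: power_abs intro: power_mono)
  qed
  \<comment> \<open>\<open>P\<close> involves finitely many coordinates, so it is continuous in the
    product topology, and \<open>P (moments \<nu>)\<close> is the integral of the approximating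
    polynomial. The three errors are controlled by \<epsilon>/3 each.\<close>
  have moments_approx: "\<exists>T. open T \<and> moments \<mu> \<in> T \<and> (\<forall>\<nu>\<in>borel_prob_measures. moments \<nu> \<in> T \<longrightarrow>
      \<bar>integral\<^sup>L \<nu> f - integral\<^sup>L \<mu> f\<bar> < \<epsilon>)"
    if \<mu>: "\<mu> \<in> borel_prob_measures" and f: "f \<in> C_real" and "\<epsilon> > 0" for \<mu> f and \<epsilon> :: real
  proof -
    obtain a n where an: "\<And>x. \<bar>f x - (\<Sum>i\<le>n. a i * e x ^ i)\<bar> < \<epsilon> / 3"
      using approx[OF f, of "\<epsilon> / 3"] \<open>\<epsilon> > 0\<close> by auto
    define P where "P y = (\<Sum>i\<le>n. a i * y i)" for y :: "nat \<Rightarrow> real"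
    have near: "\<bar>integral\<^sup>L \<nu> f - P (moments \<nu>)\<bar> \<le> \<epsilon> / 3" if \<nu>: "\<nu> \<in> borel_prob_measures" for \<nu>
    proof -
      interpret prob_space \<nu> by (rule borel_prob_measuresD(1)[OF \<nu>])
      obtain C where "\<And>x. \<bar>f x\<bar> \<le> C" using C_real_bounded[OF cpt f] by metis
      then have int_f: "integrable \<nu> f"
        using f by (intro borel_prob_measures_integrable[OF \<nu>])
          (auto simp: C_real_def intro: borel_measurable_continuous_onI)
      have int_P: "integrable \<nu> (\<lambda>x. \<Sum>i\<le>n. a i * e x ^ i)"
        using int_pow[OF \<nu>] by auto
      have "P (moments \<nu>) = integral\<^sup>L \<nu> (\<lambda>x. \<Sum>i\<le>n. a i * e x ^ i)"
        unfolding P_def moments_def using int_pow[OF \<nu>] by (subst Bochner_Integration.integral_sum) auto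
      then have "integral\<^sup>L \<nu> f - P (moments \<nu>) = integral\<^sup>L \<nu> (\<lambda>x. f x - (\<Sum>i\<le>n. a i * e x ^ i))"
        using int_f int_P by simp
      also have "\<bar>\<dots>\<bar> \<le> integral\<^sup>L \<nu> (\<lambda>x. \<bar>f x - (\<Sum>i\<le>n. a i * e x ^ i)\<bar>)"
        by (rule integral_abs_bound)
      also have "\<dots> \<le> integral\<^sup>L \<nu> (\<lambda>_. \<epsilon> / 3)"
        using int_f int_P an by (intro integral_mono) (auto intro: less_imp_le)
      finally show ?thesis by (simp add: prob_space)
    qed
    have "continuous_on UNIV P"
      unfolding P_def by (intro continuous_intros continuous_on_product_coordinates)
    then have "open {y. \<bar>P y - P (moments \<mu>)\<bar> < \<epsilon> / 3}"
      by (intro open_Collect_less continuous_intros)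
    moreover have "\<bar>integral\<^sup>L \<nu> f - integral\<^sup>L \<mu> f\<bar> < \<epsilon>"
      if "\<nu> \<in> borel_prob_measures" "\<bar>P (moments \<nu>) - P (moments \<mu>)\<bar> < \<epsilon> / 3" for \<nu>
      using near[OF that(1)] near[OF \<mu>] that(2) by linarith
    ultimately show ?thesis
      using \<open>\<epsilon> > 0\<close> by (intro exI[of _ "{y. \<bar>P y - P (moments \<mu>)\<bar> < \<epsilon> / 3}"]) auto
  qed
  \<comment> \<open>Finiteness of \<open>L \<mu>\<close> keeps the intersection of the open sets
    open, so a moment neighbourhood of \<mu> forces membership in \<open>W \<mu>\<close>, and
    Lindeloef can act on moment sequences.\<close>
  have "\<exists>T. open T \<and> moments \<mu> \<in> T \<and> (\<forall>\<nu>\<in>borel_prob_measures. moments \<nu> \<in> T \<longrightarrow> \<nu> \<in> W \<mu>)"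
    if \<mu>: "\<mu> \<in> borel_prob_measures" for \<mu>
  proof -
    have "\<forall>f\<in>L \<mu>. \<exists>T. open T \<and> moments \<mu> \<in> T \<and> (\<forall>\<nu>\<in>borel_prob_measures. moments \<nu> \<in> T \<longrightarrow>
      \<bar>integral\<^sup>L \<nu> f - integral\<^sup>L \<mu> f\<bar> < \<eta> \<mu>)"
      using moments_approx[OF \<mu> _ \<eta>[OF \<mu>]] L[OF \<mu>] by blast
    then obtain T where T: "\<forall>f\<in>L \<mu>. open (T f) \<and> moments \<mu> \<in> T f \<and>
      (\<forall>\<nu>\<in>borel_prob_measures. moments \<nu> \<in> T f \<longrightarrow> \<bar>integral\<^sup>L \<nu> f - integral\<^sup>L \<mu> f\<bar> < \<eta> \<mu>)"
      by metis
    then have "open (\<Inter>f\<in>L \<mu>. T f)" using L[OF \<mu>] by blast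
    with T show ?thesis unfolding W_def by (intro exI[of _ "\<Inter>f\<in>L \<mu>. T f"]) auto
  qed
  then obtain T where T: "\<And>\<mu>. \<mu> \<in> borel_prob_measures \<Longrightarrow> open (T \<mu>) \<and> moments \<mu> \<in> T \<mu> \<and>
      (\<forall>\<nu>\<in>borel_prob_measures. moments \<nu> \<in> T \<mu> \<longrightarrow> \<nu> \<in> W \<mu>)"
    by metis
  obtain \<F> where \<F>: "\<F> \<subseteq> T ` borel_prob_measures" "countable \<F>"
    "\<Union>\<F> = \<Union>(T ` borel_prob_measures)"
    using Lindelof[of "T ` borel_prob_measures"] T by blast
  obtain C where C: "C \<subseteq> borel_prob_measures" "countable C" "\<F> = T ` C"
    using \<F>(1,2) by (metis countable_subset_image)
  have cover: "\<exists>\<mu>\<in>C. \<nu> \<in> W \<mu>" if "\<nu> \<in> borel_prob_measures" for \<nu>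
  proof -
    have "moments \<nu> \<in> \<Union>\<F>" using T[OF that] that unfolding \<F>(3) by blast
    then show ?thesis using T that C by blast
  qed
  \<comment> \<open>If no finite subfamily works, pick \<open>\<nu> n\<close> outside the first
    \<open>n\<close> neighbourhoods. A subsequential limit lies in some \<open>W (c k)\<close>; its
    finitely many strict inequalities persist far along the subsequence, against
    \<open>r n \<ge> n > k\<close>.\<close>
  have "\<exists>S. finite S \<and> S \<subseteq> C \<and> (\<forall>\<nu>\<in>borel_prob_measures. \<exists>\<mu>\<in>S. \<nu> \<in> W \<mu>)"
  proof (rule ccontr)
    assume neg: "\<not> ?thesis"
    have "C \<noteq> {}"
    proof
      assume "C = {}"
      then have "borel_prob_measures = ({} :: 'x measure set)" using cover by blast
      then show False using neg by blast
    qed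
    define c where "c = from_nat_into C"
    have c: "C = range c"
      unfolding c_def by (rule range_from_nat_into[OF \<open>C \<noteq> {}\<close> C(2), symmetric])
    have "\<exists>\<nu>\<in>borel_prob_measures. \<forall>k<n. \<nu> \<notin> W (c k)" for n
    proof -
      have "finite (c ` {..<n})" "c ` {..<n} \<subseteq> C" using c by auto
      with neg have "\<not> (\<forall>\<nu>\<in>borel_prob_measures. \<exists>\<mu>\<in>c ` {..<n}. \<nu> \<in> W \<mu>)" by metis
      then show ?thesis by blast
    qed
    then obtain \<nu> where \<nu>: "\<And>n. \<nu> n \<in> borel_prob_measures" "\<And>n k. k < n \<Longrightarrow> \<nu> n \<notin> W (c k)"
      by metis
    obtain \<mu> r where \<mu>: "\<mu> \<in> borel_prob_measures" and r: "strict_mono (r :: nat \<Rightarrow> nat)"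
      and lim: "\<And>f. f \<in> C_real \<Longrightarrow> (\<lambda>n. integral\<^sup>L (\<nu> (r n)) f) \<longlonglongrightarrow> integral\<^sup>L \<mu> f"
      by (rule weak_sequential_compactness[where \<nu> = \<nu>, OF cpt \<nu>(1)]) (rule that)
    obtain k where k: "\<mu> \<in> W (c k)" using cover[OF \<mu>] c by auto
    have ck: "c k \<in> borel_prob_measures" using C(1) c by auto
    have "\<forall>\<^sub>F n in sequentially. \<bar>integral\<^sup>L (\<nu> (r n)) f - integral\<^sup>L (c k) f\<bar> < \<eta> (c k)"
      if "f \<in> L (c k)" for f
    proof (rule order_tendstoD(2))
      show "(\<lambda>n. \<bar>integral\<^sup>L (\<nu> (r n)) f - integral\<^sup>L (c k) f\<bar>) \<longlonglongrightarrow> \<bar>integral\<^sup>L \<mu> f - integral\<^sup>L (c k) f\<bar>"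
        using L[OF ck] that by (intro tendsto_intros lim) auto
      show "\<bar>integral\<^sup>L \<mu> f - integral\<^sup>L (c k) f\<bar> < \<eta> (c k)"
        using k that by (auto simp: W_def)
    qed
    then have "\<forall>\<^sub>F n in sequentially. \<forall>f\<in>L (c k).
        \<bar>integral\<^sup>L (\<nu> (r n)) f - integral\<^sup>L (c k) f\<bar> < \<eta> (c k)"
      using L[OF ck] by (intro eventually_ball_finite) auto
    then have "\<forall>\<^sub>F n in sequentially. \<nu> (r n) \<in> W (c k)"
      by (simp add: W_def)
    moreover have "\<forall>\<^sub>F n in sequentially. k < n" by (rule eventually_gt_at_top)
    ultimately have "\<forall>\<^sub>F n in sequentially. False"
    proof eventually_elim
      case (elim n)
      then show ?case using \<nu>(2)[of k "r n"] seq_suble[OF r, of n] by simp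
    qed
    then show False by simp
  qed
  then obtain S where S: "finite S" "S \<subseteq> C" "\<forall>\<nu>\<in>borel_prob_measures. \<exists>\<mu>\<in>S. \<nu> \<in> W \<mu>"
    by metis
  show thesis
  proof (rule that[of S])
    show "S \<subseteq> borel_prob_measures" using S(2) C(1) by (rule subset_trans)
  qed (use S(1,3) in \<open>simp_all add: W_def\<close>)
qed

section \<open>Covering numbers and growth rates\<close>

lemma covering_number_le: "finite \<W> \<Longrightarrow> \<W> \<subseteq> \<V> \<Longrightarrow> K \<subseteq> \<Union>\<W> \<Longrightarrow> covering_number \<V> K \<le> card \<W>"
  unfolding covering_number_def by (rule cInf_lower) auto

text \<open>Coverability makes the set of cardinalities non-empty; the infimum of an empty set would
  carry no information. Later lemmas assume it for the same reason.\<close>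

lemma covering_number_attained:
  assumes "finite \<V>" "K \<subseteq> \<Union>\<V>"
  obtains \<W> where "finite \<W>" "\<W> \<subseteq> \<V>" "K \<subseteq> \<Union>\<W>" "card \<W> = covering_number \<V> K"
proof -
  have "covering_number \<V> K \<in> {card \<W> |\<W>. finite \<W> \<and> \<W> \<subseteq> \<V> \<and> K \<subseteq> \<Union>\<W>}"
    unfolding covering_number_def using assms by (intro Inf_nat_def1) auto
  then show thesis using that by auto
qed

lemma covering_number_mono:
  assumes "finite \<V>" "K' \<subseteq> \<Union>\<V>" "K \<subseteq> K'"
  shows "covering_number \<V> K \<le> covering_number \<V> K'"
  using covering_number_attained[OF assms(1,2)] covering_number_le assms(3) by (metis subset_trans)

lemma covering_number_UN_le:
  assumes "finite \<V>" "finite S" "\<And>k. k \<in> S \<Longrightarrow> A k \<subseteq> \<Union>\<V>" "K \<subseteq> (\<Union>k\<in>S. A k)"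
  shows "covering_number \<V> K \<le> (\<Sum>k\<in>S. covering_number \<V> (A k))"
proof -
  have "\<forall>k\<in>S. \<exists>\<W>. finite \<W> \<and> \<W> \<subseteq> \<V> \<and> A k \<subseteq> \<Union>\<W> \<and> card \<W> = covering_number \<V> (A k)"
    using covering_number_attained[OF assms(1) assms(3)] by metis
  then obtain \<W> where \<W>: "\<forall>k\<in>S. finite (\<W> k) \<and> \<W> k \<subseteq> \<V> \<and> A k \<subseteq> \<Union>(\<W> k) \<and> card (\<W> k) = covering_number \<V> (A k)"
    by metis
  have "covering_number \<V> K \<le> card (\<Union>k\<in>S. \<W> k)"
  proof (rule covering_number_le)
    show "finite (\<Union>k\<in>S. \<W> k)" using \<W> assms(2) by blast
    show "(\<Union>k\<in>S. \<W> k) \<subseteq> \<V>" using \<W> by blast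
    have "(\<Union>k\<in>S. A k) \<subseteq> \<Union>(\<Union>k\<in>S. \<W> k)" using \<W> by blast
    with assms(4) show "K \<subseteq> \<Union>(\<Union>k\<in>S. \<W> k)" by (rule subset_trans)
  qed
  also have "\<dots> \<le> (\<Sum>k\<in>S. card (\<W> k))" by (rule card_UN_le[OF assms(2)])
  also have "\<dots> = (\<Sum>k\<in>S. covering_number \<V> (A k))" using \<W> by (intro sum.cong) auto
  finally show ?thesis .
qed

text \<open>Cover \<open>K\<close> optimally by members \<open>V\<close> of \<open>\<V>2\<close>,
  then each slice \<open>K \<inter> V\<close> by \<open>\<V>1\<close>. In logarithms: entropy of
  \<open>\<V>1\<close> is at most entropy of \<open>\<V>2\<close> plus conditional entropy.\<close>

lemma covering_number_le_mult_Max: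
  assumes "finite \<V>1" "finite \<V>2" "K \<subseteq> \<Union>\<V>1" "K \<subseteq> \<Union>\<V>2"
  shows "covering_number \<V>1 K \<le>
    covering_number \<V>2 K * Max ((\<lambda>V. covering_number \<V>1 (K \<inter> V)) ` \<V>2)"
proof -
  obtain \<W> where \<W>: "finite \<W>" "\<W> \<subseteq> \<V>2" "K \<subseteq> \<Union>\<W>" "card \<W> = covering_number \<V>2 K"
    using covering_number_attained[OF assms(2,4)] by metis
  have "covering_number \<V>1 K \<le> (\<Sum>V\<in>\<W>. covering_number \<V>1 (K \<inter> V))"
    using \<W> assms by (intro covering_number_UN_le) auto
  also have "\<dots> \<le> (\<Sum>V\<in>\<W>. Max ((\<lambda>V. covering_number \<V>1 (K \<inter> V)) ` \<V>2))"
    using \<W>(2) assms(2) by (intro sum_mono Max_ge) auto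
  finally show ?thesis using \<W>(4) by simp
qed

text \<open>A box depends only on its factors at indices in \<open>{1..d}\<close>, so restricting
  the choice functions leaves finitely many.\<close>

lemma finite_power_cover:
  assumes "finite \<U>"
  shows "finite (power_cover d \<U>)"
proof -
  have "power_cover d \<U> \<subseteq> (\<lambda>U. PiE {1..d} U) ` PiE {1..d} (\<lambda>_. \<U>)"
  proof
    fix V assume "V \<in> power_cover d \<U>"
    then obtain U where U: "V = PiE {1..d} U" "\<forall>j\<in>{1..d}. U j \<in> \<U>"
      by (auto simp: power_cover_def)
    have "V = PiE {1..d} (restrict U {1..d})" unfolding U(1) by (rule PiE_cong) simp
    moreover have "restrict U {1..d} \<in> PiE {1..d} (\<lambda>_. \<U>)" using U(2) by auto
    ultimately show "V \<in> (\<lambda>U. PiE {1..d} U) ` PiE {1..d} (\<lambda>_. \<U>)" by blast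
  qed
  then show ?thesis by (rule finite_subset) (intro finite_imageI finite_PiE assms finite_atLeastAtMost)
qed

lemma Union_power_cover:
  assumes "\<Union>\<U> = UNIV"
  shows "PiE {1..d} (\<lambda>_. UNIV) \<subseteq> \<Union>(power_cover d \<U>)"
proof
  fix x :: "nat \<Rightarrow> 'a" assume x: "x \<in> PiE {1..d} (\<lambda>_. UNIV)"
  have "\<forall>j. \<exists>U\<in>\<U>. x j \<in> U" using assms by blast
  then obtain U where "\<And>j. U j \<in> \<U> \<and> x j \<in> U j" by metis
  with x show "x \<in> \<Union>(power_cover d \<U>)"
    unfolding power_cover_def by (auto simp: PiE_def Pi_def)
qed

section \<open>Exponential growth rates\<close>

lemma elog_mono: "m \<le> n \<Longrightarrow> elog m \<le> elog n"
  by (auto simp: elog_def)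

text \<open>Trades an upper limit for a bound at each large index, which can be multiplied with
  other such bounds. Where \<open>N i = 0\<close> the bound is trivial.\<close>

lemma eventually_le_exp_of_limsup_less:
  assumes d: "filterlim d at_top sequentially"
    and less: "limsup (\<lambda>i. ereal (1 / real (d i)) * elog (N i)) < ereal c"
  shows "\<forall>\<^sub>F i in sequentially. real (N i) \<le> exp (c * real (d i))"
proof -
  have "\<forall>\<^sub>F i in sequentially. ereal (1 / real (d i)) * elog (N i) < ereal c"
    using less by (rule Limsup_lessD)
  moreover have "\<forall>\<^sub>F i in sequentially. 1 \<le> d i"
    using d by (simp add: filterlim_at_top)
  ultimately show ?thesis
  proof eventually_elim
    case (elim i)
    show ?case
    proof (cases "N i = 0")
      case False
      then have "ln (real (N i)) < c * real (d i)"
        using elim by (simp add: elog_def field_simps)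
      then have "exp (ln (real (N i))) \<le> exp (c * real (d i))" by simp
      then show ?thesis using False by simp
    qed simp
  qed
qed

text \<open>The prefactor contributes \<open>ln C / d i\<close>, which tends to 0; \<open>C\<close>
  will be the number of pieces of the approximate orbits.\<close>

lemma limsup_le_of_eventually_le_exp:
  assumes d: "filterlim d at_top sequentially" and "C > 0"
    and le: "\<forall>\<^sub>F i in sequentially. real (N i) \<le> C * exp (c * real (d i))"
  shows "limsup (\<lambda>i. ereal (1 / real (d i)) * elog (N i)) \<le> ereal c"
proof -
  \<comment> \<open>Positivity of \<open>d i\<close> matters even for \<open>N i = 0\<close>, since
    \<open>0 * (-\<infinity>) = 0\<close> in the extended reals.\<close>
  have "\<forall>\<^sub>F i in sequentially. 1 \<le> d i"
    using d by (simp add: filterlim_at_top)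
  with le have "\<forall>\<^sub>F i in sequentially.
      ereal (1 / real (d i)) * elog (N i) \<le> ereal (ln C / real (d i) + c)"
  proof eventually_elim
    case (elim i)
    show ?case
    proof (cases "N i = 0")
      case False
      then have "ln (real (N i)) \<le> ln (C * exp (c * real (d i)))"
        using elim \<open>C > 0\<close> by (subst ln_le_cancel_iff) auto
      also have "\<dots> = ln C + c * real (d i)" using \<open>C > 0\<close> by (simp add: ln_mult)
      finally show ?thesis using False elim(2) by (simp add: elog_def field_simps)
    qed (use elim(2) in \<open>simp add: elog_def\<close>)
  qed
  then have "limsup (\<lambda>i. ereal (1 / real (d i)) * elog (N i)) \<le>
      limsup (\<lambda>i. ereal (ln C / real (d i) + c))"
    by (rule Limsup_mono)
  also have "(\<lambda>i. ereal (ln C / real (d i) + c)) \<longlonglongrightarrow> ereal (0 + c)"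
    by (intro tendsto_intros real_tendsto_divide_at_top[OF tendsto_const]
        filterlim_compose[OF filterlim_real_sequentially d])
  then have "limsup (\<lambda>i. ereal (ln C / real (d i) + c)) = ereal c"
    by (intro lim_imp_Limsup) auto
  finally show ?thesis .
qed

section \<open>Approximate orbits and empirical measures\<close>

lemma approx_orbits_subset_PiE: "approx_orbits \<phi> d F \<delta> \<tau> \<subseteq> PiE {1..d} (\<lambda>_. UNIV)"
  by (auto simp: approx_orbits_def)

lemma approx_orbits_meas_subset: "approx_orbits_meas \<phi> d F \<delta> \<tau> \<mu> L \<subseteq> approx_orbits \<phi> d F \<delta> \<tau>"
  by (auto simp: approx_orbits_meas_def)

text \<open>A maximum over fewer group elements is no larger, and \<open>F' \<noteq> {}\<close>
  keeps it meaningful. One strict enough pair \<open>F\<close>, \<delta> can thus serve finitely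
  many requirements.\<close>

lemma approx_orbits_antimono:
  assumes "finite F" "F' \<subseteq> F" "F' \<noteq> {}" "\<delta> \<le> \<delta>'"
  shows "approx_orbits \<phi> d F \<delta> \<tau> \<subseteq> approx_orbits \<phi> d F' \<delta>' \<tau>"
proof -
  have "Max (g ` F') < \<delta>'" if "Max (g ` F) < \<delta>" for g :: "'a \<Rightarrow> real"
    using Max_mono[of "g ` F'" "g ` F"] that assms by fastforce
  then show ?thesis by (auto simp: approx_orbits_def)
qed

text \<open>The test functions only cut down the set of approximate orbits. Hence a measure that
  fails to be maximal has strictly smaller entropy.\<close>

lemma meas_entropy_le_top_entropy:
  fixes \<phi> :: "'g \<Rightarrow> 'x::metric_space \<Rightarrow> 'x"
  shows "meas_entropy G d \<sigma> \<phi> \<mu> \<le> top_entropy G d \<sigma> \<phi>"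
  unfolding meas_entropy_def top_entropy_def
proof (rule SUP_mono)
  fix \<U> :: "'x set set" assume \<U>: "\<U> \<in> open_covers"
  have "limsup (\<lambda>i. ereal (1 / real (d i)) *
          elog (covering_number (power_cover (d i) \<U>) (approx_orbits_meas \<phi> (d i) F \<delta> (\<sigma> i) \<mu> L)))
      \<le> limsup (\<lambda>i. ereal (1 / real (d i)) *
          elog (covering_number (power_cover (d i) \<U>) (approx_orbits \<phi> (d i) F \<delta> (\<sigma> i))))" for F \<delta> L
  proof (intro Limsup_mono always_eventually allI ereal_mult_left_mono elog_mono)
    fix i
    have fin: "finite \<U>" "\<Union>\<U> = UNIV" using \<U> by (auto simp: open_covers_def)
    show "covering_number (power_cover (d i) \<U>) (approx_orbits_meas \<phi> (d i) F \<delta> (\<sigma> i) \<mu> L)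
      \<le> covering_number (power_cover (d i) \<U>) (approx_orbits \<phi> (d i) F \<delta> (\<sigma> i))"
      by (intro covering_number_mono finite_power_cover fin approx_orbits_meas_subset
          subset_trans[OF approx_orbits_subset_PiE] Union_power_cover)
  qed simp
  moreover have "{\<lambda>_. 0} \<in> fin_subsets (C_real :: ('x \<Rightarrow> real) set)"
    by (auto simp: fin_subsets_def C_real_def)
  ultimately have "meas_entropy_cover G d \<sigma> \<phi> \<mu> \<U> \<le> top_entropy_cover G d \<sigma> \<phi> \<U>"
    unfolding meas_entropy_cover_def top_entropy_cover_def
    by (intro INF_lower2[of "{\<lambda>_. 0}"] INF_superset_mono) auto
  then show "\<exists>\<U>'\<in>open_covers. meas_entropy_cover G d \<sigma> \<phi> \<mu> \<U> \<le> top_entropy_cover G d \<sigma> \<phi> \<U>'"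
    using \<U> by blast
qed

text \<open>For \<open>d \<ge> 1\<close> the average of the point masses at \<open>x 1\<close>, ...,
  \<open>x d\<close>. As the image of a pmf it is a probability measure even for
  \<open>d = 0\<close>.\<close>

definition empirical_measure :: "nat \<Rightarrow> (nat \<Rightarrow> 'x::topological_space) \<Rightarrow> 'x measure" where
  "empirical_measure d x = distr (measure_pmf (pmf_of_set {1..d})) borel x"

lemma empirical_measure_borel_prob: "empirical_measure d x \<in> borel_prob_measures"
  by (simp add: empirical_measure_def borel_prob_measures_def measure_pmf.prob_space_distr)

lemma integral_empirical_measure:
  assumes "d \<ge> 1" "f \<in> C_real"
  shows "integral\<^sup>L (empirical_measure d x) f = 1 / real d * (\<Sum>j\<in>{1..d}. f (x j))"
proof -
  have "f \<in> borel_measurable borel"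
    using assms(2) by (auto simp: C_real_def intro: borel_measurable_continuous_onI)
  then have "integral\<^sup>L (empirical_measure d x) f =
      measure_pmf.expectation (pmf_of_set {1..d}) (\<lambda>j. f (x j))"
    unfolding empirical_measure_def by (subst integral_distr) auto
  also have "\<dots> = (\<Sum>j\<in>{1..d}. f (x j)) / real (card {1..d})"
    using assms(1) by (intro integral_pmf_of_set) auto
  finally show ?thesis by simp
qed

section \<open>Patching local entropy estimates over finitely many measures\<close>

theorem corollary3p7:
  fixes G :: "('g, 'm) monoid_scheme"
    and d :: "nat \<Rightarrow> nat"
    and \<sigma> :: "nat \<Rightarrow> 'g \<Rightarrow> nat \<Rightarrow> nat"
    and \<phi> :: "'g \<Rightarrow> 'x::metric_space \<Rightarrow> 'x"
  assumes "group G"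
    and "countable (carrier G)"
    and "sofic_approximation G d \<sigma>"
    and "compact (UNIV :: 'x set)"
    and "continuous_action G \<phi>"
    and "asymptotically_h_expansive G d \<sigma> \<phi>"
  shows "\<exists>\<mu>. maximal_entropy_measure G d \<sigma> \<phi> \<mu>"
proof (rule ccontr)
  assume no_max: "\<not> ?thesis"
  have d_lim: "filterlim d at_top sequentially"
    using assms(3) by (simp add: sofic_approximation_def)
  let ?h = "top_entropy G d \<sigma> \<phi>"
  let ?M = "borel_prob_measures :: 'x measure set"
  let ?orb = "\<lambda>i F \<delta>. approx_orbits \<phi> (d i) F \<delta> (\<sigma> i)"
  let ?orb\<mu> = "\<lambda>i F \<delta> \<mu> L. approx_orbits_meas \<phi> (d i) F \<delta> (\<sigma> i) \<mu> L"
  let ?N = "\<lambda>i \<U> K. covering_number (power_cover (d i) \<U>) K"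
  \<comment> \<open>None of these data refers to the cover \<open>\<V>\<close> used later to bound
    h(G,X), so the finite set \<open>S\<close> and the numbers \<open>b\<close> are fixed before
    \<open>\<V>\<close>.\<close>
  let ?P = "\<lambda>\<mu> a b \<U> L F \<delta>. ereal b < ?h \<and> \<U> \<in> open_covers \<and>
      cond_entropy G d \<sigma> \<phi> \<U> < ereal (b - a) \<and> L \<in> fin_subsets C_real \<and>
      F \<in> fin_subsets (carrier G) \<and> 0 < \<delta> \<and>
      (\<forall>\<^sub>F i in sequentially. real (?N i \<U> (?orb\<mu> i F \<delta> \<mu> L)) \<le> exp (a * real (d i)))"
  have local_data: "\<exists>a b \<U> L F \<delta>. ?P \<mu> a b \<U> L F \<delta>" if \<mu>: "\<mu> \<in> ?M" for \<mu>
  proof -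
    have "meas_entropy G d \<sigma> \<phi> \<mu> < ?h"
      using no_max \<mu> meas_entropy_le_top_entropy[of G d \<sigma> \<phi> \<mu>]
      by (auto simp: maximal_entropy_measure_def order.strict_iff_order)
    \<comment> \<open>Reals strictly between the entropies exist even if the lower one is
      -\<infinity> or the upper one is \<infinity>; their gap \<open>b - a\<close> is positive and
      so exceeds the tail entropy.\<close>
    then obtain b where b: "meas_entropy G d \<sigma> \<phi> \<mu> < ereal b" "ereal b < ?h"
      using ereal_dense2 by blast
    from ereal_dense2[OF b(1)] obtain a where a: "meas_entropy G d \<sigma> \<phi> \<mu> < ereal a" "ereal a < ereal b"
      by blast
    have "tail_entropy G d \<sigma> \<phi> \<le> 0"
      using assms(6) by (simp add: asymptotically_h_expansive_def)
    also have "0 < ereal (b - a)" using a(2) by simp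
    finally obtain \<U> where \<U>: "\<U> \<in> open_covers" "cond_entropy G d \<sigma> \<phi> \<U> < ereal (b - a)"
      unfolding tail_entropy_def by (auto simp: INF_less_iff)
    have "meas_entropy_cover G d \<sigma> \<phi> \<mu> \<U> \<le> meas_entropy G d \<sigma> \<phi> \<mu>"
      unfolding meas_entropy_def using \<U>(1) by (rule SUP_upper)
    then have "meas_entropy_cover G d \<sigma> \<phi> \<mu> \<U> < ereal a" using a(1) by (rule le_less_trans)
    then obtain L F \<delta> where LF: "L \<in> fin_subsets C_real" "F \<in> fin_subsets (carrier G)" "0 < \<delta>"
      and "limsup (\<lambda>i. ereal (1 / real (d i)) * elog (?N i \<U> (?orb\<mu> i F \<delta> \<mu> L))) < ereal a"
      unfolding meas_entropy_cover_def by (auto simp: INF_less_iff)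
    from eventually_le_exp_of_limsup_less[OF d_lim this(4)] LF \<U> b(2) show ?thesis by blast
  qed
  then have "\<forall>\<mu>\<in>?M. \<exists>a b \<U> L F \<delta>. ?P \<mu> a b \<U> L F \<delta>" by blast
  then obtain a b \<U> L F \<delta> where data: "\<And>\<mu>. \<mu> \<in> ?M \<Longrightarrow> ?P \<mu> (a \<mu>) (b \<mu>) (\<U> \<mu>) (L \<mu>) (F \<mu>) (\<delta> \<mu>)"
    unfolding bchoice_iff by blast
  have L_fin: "\<And>\<mu>. \<mu> \<in> ?M \<Longrightarrow> finite (L \<mu>) \<and> L \<mu> \<subseteq> C_real"
    using data unfolding fin_subsets_def by blast
  have \<delta>_pos: "\<And>\<mu>. \<mu> \<in> ?M \<Longrightarrow> \<delta> \<mu> > 0"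
    using data by blast
  obtain S where finS: "finite S" and S: "S \<subseteq> ?M"
    and cover: "\<And>\<nu>. \<nu> \<in> ?M \<Longrightarrow> \<exists>\<mu>\<in>S. \<forall>f\<in>L \<mu>. \<bar>integral\<^sup>L \<nu> f - integral\<^sup>L \<mu> f\<bar> < \<delta> \<mu>"
    by (rule weak_finite_subcover[where L = L and \<eta> = \<delta>, OF assms(4) L_fin \<delta>_pos])
      (assumption | rule that)+
  \<comment> \<open>Some probability measure exists, for instance an empirical one, and an empty
    \<open>S\<close> could not account for it. \<open>Max\<close> and \<open>Min\<close> over
    \<open>S\<close> rely on this.\<close>
  have "S \<noteq> {}" using cover[OF empirical_measure_borel_prob[of 0 undefined]] by blast
  have bound: "top_entropy_cover G d \<sigma> \<phi> \<V> \<le> ereal (Max (b ` S))" if \<V>: "\<V> \<in> open_covers" for \<V>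
  proof -
    let ?Q = "\<lambda>\<mu> F' \<delta>'. F' \<in> fin_subsets (carrier G) \<and> 0 < \<delta>' \<and>
        (\<forall>\<^sub>F i in sequentially. real (Max ((\<lambda>V. ?N i \<V> (?orb i F' \<delta>' \<inter> V)) ` power_cover (d i) (\<U> \<mu>)))
          \<le> exp ((b \<mu> - a \<mu>) * real (d i)))"
    have "\<exists>F' \<delta>'. ?Q \<mu> F' \<delta>'" if "\<mu> \<in> S" for \<mu>
    proof -
      have "cond_entropy_covers G d \<sigma> \<phi> \<V> (\<U> \<mu>) \<le> cond_entropy G d \<sigma> \<phi> (\<U> \<mu>)"
        unfolding cond_entropy_def using \<V> by (rule SUP_upper)
      also have "\<dots> < ereal (b \<mu> - a \<mu>)" using data S that by blast
      finally obtain F' \<delta>' where F': "F' \<in> fin_subsets (carrier G)" "0 < \<delta>'"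
        and "limsup (\<lambda>i. ereal (1 / real (d i)) *
          elog (Max ((\<lambda>V. ?N i \<V> (?orb i F' \<delta>' \<inter> V)) ` power_cover (d i) (\<U> \<mu>)))) < ereal (b \<mu> - a \<mu>)"
        unfolding cond_entropy_covers_def by (auto simp: INF_less_iff)
      from eventually_le_exp_of_limsup_less[OF d_lim this(3)] F' show ?thesis by blast
    qed
    then have "\<forall>\<mu>\<in>S. \<exists>F' \<delta>'. ?Q \<mu> F' \<delta>'" by blast
    then obtain F' \<delta>' where data': "\<And>\<mu>. \<mu> \<in> S \<Longrightarrow> ?Q \<mu> (F' \<mu>) (\<delta>' \<mu>)"
      unfolding bchoice_iff by blast
    \<comment> \<open>One set of group elements and one tolerance, strict enough for the local and
      the conditional data at every measure in \<open>S\<close>.\<close>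
    define F0 where "F0 = (\<Union>\<mu>\<in>S. F \<mu> \<union> F' \<mu>)"
    define \<delta>0 where "\<delta>0 = Min ((\<lambda>\<mu>. min (\<delta> \<mu>) (\<delta>' \<mu>)) ` S)"
    have F: "finite (F \<mu>)" "F \<mu> \<noteq> {}" "F \<mu> \<subseteq> carrier G" "\<delta> \<mu> > 0"
      "finite (F' \<mu>)" "F' \<mu> \<noteq> {}" "F' \<mu> \<subseteq> carrier G" "\<delta>' \<mu> > 0" if "\<mu> \<in> S" for \<mu>
      using data[of \<mu>] data'[OF that] that S by (auto simp: fin_subsets_def)
    have finF0: "finite F0" unfolding F0_def using finS F by auto
    have F0: "F0 \<in> fin_subsets (carrier G)"
    proof -
      obtain \<mu> where "\<mu> \<in> S" using \<open>S \<noteq> {}\<close> by blast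
      then have "F0 \<noteq> {}" unfolding F0_def using F(2)[of \<mu>] by blast
      moreover have "F0 \<subseteq> carrier G" unfolding F0_def using F(3,7) by (intro UN_least Un_least)
      ultimately show ?thesis using finF0 by (simp add: fin_subsets_def)
    qed
    have \<delta>0_pos: "\<delta>0 > 0" unfolding \<delta>0_def using finS \<open>S \<noteq> {}\<close> F by auto
    have \<delta>0_le: "\<delta>0 \<le> \<delta> \<mu>" "\<delta>0 \<le> \<delta>' \<mu>" if "\<mu> \<in> S" for \<mu>
    proof -
      have "\<delta>0 \<le> min (\<delta> \<mu>) (\<delta>' \<mu>)" unfolding \<delta>0_def using finS that by (intro Min_le) auto
      then show "\<delta>0 \<le> \<delta> \<mu>" "\<delta>0 \<le> \<delta>' \<mu>" by auto
    qed
    have fin_V: "finite (power_cover (d i) \<V>)" "PiE {1..d i} (\<lambda>_. UNIV) \<subseteq> \<Union>(power_cover (d i) \<V>)" for i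
      using \<V> by (auto simp: open_covers_def intro!: finite_power_cover Union_power_cover[THEN subsetD])
    have fin_U: "finite (power_cover (d i) (\<U> \<mu>))"
      "PiE {1..d i} (\<lambda>_. UNIV) \<subseteq> \<Union>(power_cover (d i) (\<U> \<mu>))"
      "power_cover (d i) (\<U> \<mu>) \<noteq> {}" if "\<mu> \<in> S" for i \<mu>
    proof -
      have \<U>: "finite (\<U> \<mu>)" "\<Union>(\<U> \<mu>) = UNIV"
        using data[of \<mu>] that S by (auto simp: open_covers_def)
      show "finite (power_cover (d i) (\<U> \<mu>))"
        using \<U>(1) by (rule finite_power_cover)
      show sub: "PiE {1..d i} (\<lambda>_. UNIV) \<subseteq> \<Union>(power_cover (d i) (\<U> \<mu>))"
        using \<U>(2) by (rule Union_power_cover)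
      \<comment> \<open>An arbitrary tuple lies in some box, so \<open>Max\<close> over the boxes is
        taken over a non-empty set.\<close>
      have "restrict undefined {1..d i} \<in> PiE {1..d i} (\<lambda>_. UNIV :: 'x set)" by auto
      with sub show "power_cover (d i) (\<U> \<mu>) \<noteq> {}" by blast
    qed
    have d_pos: "\<forall>\<^sub>F i in sequentially. 1 \<le> d i"
      using d_lim by (simp add: filterlim_at_top)
    have "\<forall>\<^sub>F i in sequentially. \<forall>\<mu>\<in>S.
        real (?N i (\<U> \<mu>) (?orb\<mu> i (F \<mu>) (\<delta> \<mu>) \<mu> (L \<mu>))) \<le> exp (a \<mu> * real (d i)) \<and>
        real (Max ((\<lambda>V. ?N i \<V> (?orb i (F' \<mu>) (\<delta>' \<mu>) \<inter> V)) ` power_cover (d i) (\<U> \<mu>)))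
          \<le> exp ((b \<mu> - a \<mu>) * real (d i))"
      using data data' S by (intro eventually_ball_finite[OF finS] ballI eventually_conj) blast+
    with d_pos have "\<forall>\<^sub>F i in sequentially.
        real (?N i \<V> (?orb i F0 \<delta>0)) \<le> real (card S) * exp (Max (b ` S) * real (d i))"
    proof eventually_elim
      case (elim i)
      \<comment> \<open>The approximate orbits with statistics near \<mu>. These pieces exhaust all
        approximate orbits, as each empirical measure is near some member of
        \<open>S\<close>.\<close>
      define A where "A \<mu> = ?orb i F0 \<delta>0 \<inter> ?orb\<mu> i (F \<mu>) (\<delta> \<mu>) \<mu> (L \<mu>)" for \<mu>
      have A_PiE: "A \<mu> \<subseteq> PiE {1..d i} (\<lambda>_. UNIV)" for \<mu>
        using approx_orbits_subset_PiE unfolding A_def by blast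
      have "?orb i F0 \<delta>0 \<subseteq> (\<Union>\<mu>\<in>S. A \<mu>)"
      proof
        fix x assume x: "x \<in> ?orb i F0 \<delta>0"
        obtain \<mu> where \<mu>: "\<mu> \<in> S" and near:
          "\<forall>f\<in>L \<mu>. \<bar>integral\<^sup>L (empirical_measure (d i) x) f - integral\<^sup>L \<mu> f\<bar> < \<delta> \<mu>"
          using cover[OF empirical_measure_borel_prob] by blast
        have L: "finite (L \<mu>)" "L \<mu> \<noteq> {}" "L \<mu> \<subseteq> C_real"
          using data[of \<mu>] \<mu> S by (auto simp: fin_subsets_def)
        have "Max ((\<lambda>f. \<bar>1 / real (d i) * (\<Sum>j\<in>{1..d i}. f (x j)) - integral\<^sup>L \<mu> f\<bar>) ` L \<mu>) < \<delta> \<mu>"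
        proof (subst Max_less_iff, safe)
          fix f assume f: "f \<in> L \<mu>"
          then show "\<bar>1 / real (d i) * (\<Sum>j\<in>{1..d i}. f (x j)) - integral\<^sup>L \<mu> f\<bar> < \<delta> \<mu>"
            using near L(3) integral_empirical_measure[OF elim(1), of f x] by (metis subsetD)
        qed (use L in auto)
        moreover have "x \<in> ?orb i (F \<mu>) (\<delta> \<mu>)"
          using x approx_orbits_antimono[OF finF0 _ F(2)[OF \<mu>] \<delta>0_le(1)[OF \<mu>]] \<mu>
          unfolding F0_def by blast
        ultimately have "x \<in> A \<mu>" using x by (simp add: A_def approx_orbits_meas_def)
        with \<mu> show "x \<in> (\<Union>\<mu>\<in>S. A \<mu>)" by blast
      qed
      then have "?N i \<V> (?orb i F0 \<delta>0) \<le> (\<Sum>\<mu>\<in>S. ?N i \<V> (A \<mu>))"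
        by (intro covering_number_UN_le fin_V finS subset_trans[OF A_PiE])
      then have "real (?N i \<V> (?orb i F0 \<delta>0)) \<le> (\<Sum>\<mu>\<in>S. real (?N i \<V> (A \<mu>)))"
        by (metis of_nat_le_iff of_nat_sum)
      also have "\<dots> \<le> (\<Sum>\<mu>\<in>S. exp (Max (b ` S) * real (d i)))"
      proof (rule sum_mono)
        fix \<mu> assume \<mu>: "\<mu> \<in> S"
        have "?orb i F0 \<delta>0 \<subseteq> ?orb i (F' \<mu>) (\<delta>' \<mu>)"
          using approx_orbits_antimono[OF finF0 _ F(6)[OF \<mu>] \<delta>0_le(2)[OF \<mu>]] \<mu>
          unfolding F0_def by blast
        then have sub: "A \<mu> \<inter> V \<subseteq> ?orb i (F' \<mu>) (\<delta>' \<mu>) \<inter> V" for V by (auto simp: A_def)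
        \<comment> \<open>\<open>A \<mu>\<close> lies in both sets of approximate orbits. So the
          first factor is bounded by the local count near \<mu>, of rate \<open>a \<mu>\<close>, and
          the second by the conditional count given \<open>\<U> \<mu>\<close>, of rate
          \<open>b \<mu> - a \<mu>\<close>.\<close>
        have "?N i \<V> (A \<mu>) \<le> ?N i (\<U> \<mu>) (A \<mu>) *
            Max ((\<lambda>V. ?N i \<V> (A \<mu> \<inter> V)) ` power_cover (d i) (\<U> \<mu>))"
          by (intro covering_number_le_mult_Max fin_V fin_U \<mu> subset_trans[OF A_PiE])
        also have "\<dots> \<le> ?N i (\<U> \<mu>) (?orb\<mu> i (F \<mu>) (\<delta> \<mu>) \<mu> (L \<mu>)) *
            Max ((\<lambda>V. ?N i \<V> (?orb i (F' \<mu>) (\<delta>' \<mu>) \<inter> V)) ` power_cover (d i) (\<U> \<mu>))"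
        proof (rule mult_le_mono)
          show "?N i (\<U> \<mu>) (A \<mu>) \<le> ?N i (\<U> \<mu>) (?orb\<mu> i (F \<mu>) (\<delta> \<mu>) \<mu> (L \<mu>))"
          proof (rule covering_number_mono[OF fin_U(1)[OF \<mu>]])
            show "?orb\<mu> i (F \<mu>) (\<delta> \<mu>) \<mu> (L \<mu>) \<subseteq> \<Union>(power_cover (d i) (\<U> \<mu>))"
              using approx_orbits_meas_subset approx_orbits_subset_PiE fin_U(2)[OF \<mu>]
              by (rule subset_trans[OF subset_trans])
            show "A \<mu> \<subseteq> ?orb\<mu> i (F \<mu>) (\<delta> \<mu>) \<mu> (L \<mu>)" by (simp add: A_def)
          qed
          show "Max ((\<lambda>V. ?N i \<V> (A \<mu> \<inter> V)) ` power_cover (d i) (\<U> \<mu>)) \<le>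
              Max ((\<lambda>V. ?N i \<V> (?orb i (F' \<mu>) (\<delta>' \<mu>) \<inter> V)) ` power_cover (d i) (\<U> \<mu>))"
          proof (rule Max.boundedI)
            fix n assume "n \<in> (\<lambda>V. ?N i \<V> (A \<mu> \<inter> V)) ` power_cover (d i) (\<U> \<mu>)"
            then obtain V where V: "V \<in> power_cover (d i) (\<U> \<mu>)" "n = ?N i \<V> (A \<mu> \<inter> V)" by blast
            have "n \<le> ?N i \<V> (?orb i (F' \<mu>) (\<delta>' \<mu>) \<inter> V)"
              unfolding V(2)
            proof (rule covering_number_mono[OF fin_V(1) _ sub])
              show "?orb i (F' \<mu>) (\<delta>' \<mu>) \<inter> V \<subseteq> \<Union>(power_cover (d i) \<V>)"
                using subset_trans[OF approx_orbits_subset_PiE fin_V(2)] by (rule le_infI1)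
            qed
            also have "\<dots> \<le> Max ((\<lambda>V. ?N i \<V> (?orb i (F' \<mu>) (\<delta>' \<mu>) \<inter> V)) ` power_cover (d i) (\<U> \<mu>))"
              using V(1) fin_U(1)[OF \<mu>] by (intro Max_ge) auto
            finally show "n \<le> Max ((\<lambda>V. ?N i \<V> (?orb i (F' \<mu>) (\<delta>' \<mu>) \<inter> V)) ` power_cover (d i) (\<U> \<mu>))" .
          qed (use fin_U[OF \<mu>] in auto)
        qed
        finally have "real (?N i \<V> (A \<mu>)) \<le> real (?N i (\<U> \<mu>) (?orb\<mu> i (F \<mu>) (\<delta> \<mu>) \<mu> (L \<mu>))) *
            real (Max ((\<lambda>V. ?N i \<V> (?orb i (F' \<mu>) (\<delta>' \<mu>) \<inter> V)) ` power_cover (d i) (\<U> \<mu>)))"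
          by (metis of_nat_le_iff of_nat_mult)
        also have "\<dots> \<le> exp (a \<mu> * real (d i)) * exp ((b \<mu> - a \<mu>) * real (d i))"
          using elim(2) \<mu> by (intro mult_mono) auto
        also have "\<dots> = exp (b \<mu> * real (d i))"
          by (simp add: exp_add[symmetric] algebra_simps)
        also have "\<dots> \<le> exp (Max (b ` S) * real (d i))"
          using finS \<mu> by (auto intro!: mult_right_mono)
        finally show "real (?N i \<V> (A \<mu>)) \<le> exp (Max (b ` S) * real (d i))" .
      qed
      finally show ?case by simp
    qed
    \<comment> \<open>The factor \<open>card S\<close> is independent of \<open>i\<close> and
      disappears from the growth rate.\<close>
    then have "limsup (\<lambda>i. ereal (1 / real (d i)) * elog (?N i \<V> (?orb i F0 \<delta>0))) \<le> ereal (Max (b ` S))"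
      using finS \<open>S \<noteq> {}\<close> by (intro limsup_le_of_eventually_le_exp[OF d_lim]) (auto simp: card_gt_0_iff)
    then show ?thesis
      unfolding top_entropy_cover_def using F0 \<delta>0_pos by (intro INF_lower2) auto
  qed
  have "?h \<le> ereal (Max (b ` S))"
    unfolding top_entropy_def by (rule SUP_least) (rule bound)
  \<comment> \<open>Finiteness of \<open>S\<close> is decisive: the maximum is one of the
    \<open>b \<mu>\<close> and stays strictly below h(G,X), whereas an infinite supremum could reach
    it.\<close>
  moreover have "Max (b ` S) \<in> b ` S"
    using finS \<open>S \<noteq> {}\<close> by (intro Max_in) auto
  then obtain \<mu> where \<mu>: "\<mu> \<in> S" "Max (b ` S) = b \<mu>" by blast
  moreover have "ereal (b \<mu>) < ?h" using data \<mu>(1) S by blast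
  ultimately show False by simp
qed

end
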